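(* Let $G$ be a group such that, for all but finitely many primes $p$, $G$ is residually $p$. Then $G$ is $\mathbf{Q}$-faithful.
   Context: For a prime $p$, a group $G$ is residually $p$ if for every $1\ne g\in G$ there is a normal subgroup of $G$ of finite $p$-power index not containing $g$. A $\mathbf{Q}$-group is a group $H$ with a map $H\times\mathbf{Q}\to H$, $(h,\alpha)\mapsto h^\alpha$, such that $h^1=h$, $h^0=1$, $1^\alpha=1$, $h^{\alpha+\beta}=h^\alpha h^\beta$, $h^{\alpha\beta}=(h^\alpha)^\beta$, $(g^{-1}hg)^\alpha=g^{-1}h^\alpha g$, and $(gh)^\alpha=g^\alpha h^\alpha$ whenever $g$ and $h$ commute; equivalently, a group in which every element has a unique $n$-th root for every positive integer $n$. The tensor completion of a group $G$ over $\mathbf{Q}$ is the $\mathbf{Q}$-group $G^{\mathbf{Q}}$ with a homomorphism $\lambda:G\to G^{\mathbf{Q}}$ that is universal: every homomorphism from $G$ to a $\mathbf{Q}$-group factors uniquely through $\lambda$ via a homomorphism of $\mathbf{Q}$-groups. $G$ is $\mathbf{Q}$-faithful if $\lambda$ is injective. *)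

theory Defs
  imports Complex_Main "HOL-Algebra.Coset" "HOL-Computational_Algebra.Primes"
begin

section \<open>Residually \<open>p\<close> groups\<close>

text \<open>Since \<open>p ^ k > 0\<close> for prime \<open>p\<close> and infinite sets have \<open>card\<close> zero, the cardinality condition
  forces the index to be finite.\<close>

definition residually_p :: "nat \<Rightarrow> ('a, 'm) monoid_scheme \<Rightarrow> bool" where
  "residually_p p G \<longleftrightarrow>
     (\<forall>g \<in> carrier G. g \<noteq> \<one>\<^bsub>G\<^esub> \<longrightarrow>
        (\<exists>N. N \<lhd> G \<and> (\<exists>k::nat. card (rcosets\<^bsub>G\<^esub> N) = p ^ k) \<and> g \<notin> N))"


section \<open>Groups with rational exponents\<close>

record 'a qgroup = "'a monoid" +
  qpow :: "'a \<Rightarrow> rat \<Rightarrow> 'a"  (infixr \<open>\<^bold>^\<index>\<close> 75)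

locale Q_group = group H for H :: "('a, 'm) qgroup_scheme" (structure) +
  assumes qpow_closed: "h \<in> carrier H \<Longrightarrow> h \<^bold>^ \<alpha> \<in> carrier H"
    and qpow_one: "h \<in> carrier H \<Longrightarrow> h \<^bold>^ 1 = h"
    and qpow_zero: "h \<in> carrier H \<Longrightarrow> h \<^bold>^ 0 = \<one>"
    and one_qpow: "\<one> \<^bold>^ \<alpha> = \<one>"
    and qpow_add: "h \<in> carrier H \<Longrightarrow> h \<^bold>^ (\<alpha> + \<beta>) = h \<^bold>^ \<alpha> \<otimes> h \<^bold>^ \<beta>"
    and qpow_mult: "h \<in> carrier H \<Longrightarrow> h \<^bold>^ (\<alpha> * \<beta>) = (h \<^bold>^ \<alpha>) \<^bold>^ \<beta>"
    and qpow_conj: "\<lbrakk>g \<in> carrier H; h \<in> carrier H\<rbrakk> \<Longrightarrow>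
          (inv g \<otimes> h \<otimes> g) \<^bold>^ \<alpha> = inv g \<otimes> h \<^bold>^ \<alpha> \<otimes> g"
    and qpow_commute: "\<lbrakk>g \<in> carrier H; h \<in> carrier H; g \<otimes> h = h \<otimes> g\<rbrakk> \<Longrightarrow>
          (g \<otimes> h) \<^bold>^ \<alpha> = g \<^bold>^ \<alpha> \<otimes> h \<^bold>^ \<alpha>"

definition Q_hom :: "('a, 'm) qgroup_scheme \<Rightarrow> ('b, 'n) qgroup_scheme \<Rightarrow> ('a \<Rightarrow> 'b) set" where
  "Q_hom H K = {\<phi> \<in> hom H K. \<forall>h \<in> carrier H. \<forall>\<alpha>. \<phi> (h \<^bold>^\<^bsub>H\<^esub> \<alpha>) = \<phi> h \<^bold>^\<^bsub>K\<^esub> \<alpha>}"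


section \<open>The universal property of the tensor completion\<close>

text \<open>A formula of HOL can only quantify over test groups \<open>K\<close> carried by one fixed type, so that type
  is a parameter. Uniqueness of the factorisation is uniqueness on \<open>carrier H\<close>, whence
  \<^const>\<open>extensional\<close>.\<close>

definition is_tensor_completion ::
    "'c itself \<Rightarrow> ('a, 'm) monoid_scheme \<Rightarrow> 'b qgroup \<Rightarrow> ('a \<Rightarrow> 'b) \<Rightarrow> bool" where
  "is_tensor_completion (_ :: 'c itself) G H l \<longleftrightarrow>
     Q_group H \<and> l \<in> hom G H \<and>
     (\<forall>(K :: 'c qgroup) f. Q_group K \<longrightarrow> f \<in> hom G K \<longrightarrow>
        (\<exists>!\<phi>. \<phi> \<in> Q_hom H K \<and> \<phi> \<in> extensional (carrier H) \<and>
              (\<forall>g \<in> carrier G. \<phi> (l g) = f g)))"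

text \<open>Terms over \<open>'a\<close> in the signature of \<open>\<rat>\<close>-groups. Sets of such terms form a type large enough
  to carry a tensor completion of any group over \<open>'a\<close>.\<close>

datatype 'a qterm = Gen 'a | One | Mul "'a qterm" "'a qterm" | Inv "'a qterm" | QPow "'a qterm" rat

text \<open>Fixing the type of sets of terms loses nothing: a tensor completion carried by this type exists
  (\<open>tensor_completion_universal\<close>), is universal for \<open>\<rat>\<close>-groups on every type
  (\<open>is_tensor_completion_any_type\<close>), and injectivity does not depend on the chosen tensor completion
  (\<open>Q_faithful_iff\<close>).\<close>

definition Q_faithful :: "('a, 'm) monoid_scheme \<Rightarrow> bool" where
  "Q_faithful G \<longleftrightarrow>
     (\<exists>(H :: 'a qterm set qgroup) l.
        is_tensor_completion TYPE('a qterm set) G H l \<and> inj_on l (carrier G))"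


section \<open>Existence and independence of the carrier type\<close>

text \<open>The tensor completion as the group of terms modulo the laws of \<open>\<rat>\<close>-groups and the
  multiplication table of \<open>G\<close>. Generators outside \<open>carrier G\<close> are made trivial, which saves a
  well-formedness condition on terms.\<close>

inductive qeq :: "('a, 'm) monoid_scheme \<Rightarrow> 'a qterm \<Rightarrow> 'a qterm \<Rightarrow> bool" for G where
  refl: "qeq G s s"
| sym: "qeq G s t \<Longrightarrow> qeq G t s"
| trans: "qeq G s t \<Longrightarrow> qeq G t u \<Longrightarrow> qeq G s u"
| mul_cong: "qeq G s s' \<Longrightarrow> qeq G t t' \<Longrightarrow> qeq G (Mul s t) (Mul s' t')"
| inv_cong: "qeq G s s' \<Longrightarrow> qeq G (Inv s) (Inv s')"
| pow_cong: "qeq G s s' \<Longrightarrow> qeq G (QPow s \<alpha>) (QPow s' \<alpha>)"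
| assoc: "qeq G (Mul (Mul s t) u) (Mul s (Mul t u))"
| one_left: "qeq G (Mul One s) s"
| inv_left: "qeq G (Mul (Inv s) s) One"
| pow_one: "qeq G (QPow s 1) s"
| pow_zero: "qeq G (QPow s 0) One"
| one_pow: "qeq G (QPow One \<alpha>) One"
| pow_add: "qeq G (QPow s (\<alpha> + \<beta>)) (Mul (QPow s \<alpha>) (QPow s \<beta>))"
| pow_mult: "qeq G (QPow s (\<alpha> * \<beta>)) (QPow (QPow s \<alpha>) \<beta>)"
| pow_conj: "qeq G (QPow (Mul (Mul (Inv t) s) t) \<alpha>) (Mul (Mul (Inv t) (QPow s \<alpha>)) t)"
| pow_commute: "qeq G (Mul s t) (Mul t s) \<Longrightarrow> qeq G (QPow (Mul s t) \<alpha>) (Mul (QPow s \<alpha>) (QPow t \<alpha>))"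
| gen_mult: "x \<in> carrier G \<Longrightarrow> y \<in> carrier G \<Longrightarrow> qeq G (Gen (x \<otimes>\<^bsub>G\<^esub> y)) (Mul (Gen x) (Gen y))"
| gen_outside: "x \<notin> carrier G \<Longrightarrow> qeq G (Gen x) One"

definition qcls :: "('a, 'm) monoid_scheme \<Rightarrow> 'a qterm \<Rightarrow> 'a qterm set" where
  "qcls G t = {s. qeq G t s}"

definition qrep :: "'a qterm set \<Rightarrow> 'a qterm" where
  "qrep A = (SOME a. a \<in> A)"

definition tensor_completion :: "('a, 'm) monoid_scheme \<Rightarrow> 'a qterm set qgroup" where
  "tensor_completion G =
     \<lparr>carrier = range (qcls G),
      monoid.mult = (\<lambda>A B. qcls G (Mul (qrep A) (qrep B))),
      one = qcls G One,
      qpow = (\<lambda>A \<alpha>. qcls G (QPow (qrep A) \<alpha>))\<rparr>"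

definition tensor_map :: "('a, 'm) monoid_scheme \<Rightarrow> 'a \<Rightarrow> 'a qterm set" where
  "tensor_map G x = qcls G (Gen x)"

lemma qcls_eq_iff: "qcls G s = qcls G t \<longleftrightarrow> qeq G s t"
  unfolding qcls_def using qeq.refl qeq.sym qeq.trans by blast

lemma qeq_qrep: "qeq G (qrep (qcls G t)) t"
  unfolding qrep_def by (rule someI2[of _ t]) (auto simp: qcls_def intro: qeq.refl qeq.sym)

lemma tc_simps:
  "carrier (tensor_completion G) = range (qcls G)"
  "qcls G s \<otimes>\<^bsub>tensor_completion G\<^esub> qcls G t = qcls G (Mul s t)"
  "\<one>\<^bsub>tensor_completion G\<^esub> = qcls G One"
  "qcls G s \<^bold>^\<^bsub>tensor_completion G\<^esub> \<alpha> = qcls G (QPow s \<alpha>)"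
  by (auto simp: tensor_completion_def qcls_eq_iff intro: qeq.mul_cong qeq.pow_cong qeq_qrep)

lemma tc_group: "group (tensor_completion G)"
proof (rule groupI)
  show "\<exists>y \<in> carrier (tensor_completion G). y \<otimes>\<^bsub>tensor_completion G\<^esub> x = \<one>\<^bsub>tensor_completion G\<^esub>"
    if "x \<in> carrier (tensor_completion G)" for x
  proof -
    obtain t where "x = qcls G t" using \<open>x \<in> _\<close> by (auto simp: tc_simps)
    then have "qcls G (Inv t) \<otimes>\<^bsub>tensor_completion G\<^esub> x = \<one>\<^bsub>tensor_completion G\<^esub>"
      by (simp add: tc_simps qcls_eq_iff qeq.inv_left)
    then show ?thesis by (auto simp: tc_simps)
  qed
qed (clarsimp simp: tc_simps rangeI qcls_eq_iff qeq.assoc qeq.one_left)+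

lemma tc_inv: "inv\<^bsub>tensor_completion G\<^esub> (qcls G t) = qcls G (Inv t)"
  by (rule group.inv_equality[OF tc_group])
     (auto simp: tc_simps qcls_eq_iff intro: qeq.inv_left)

lemma tc_Q_group: "Q_group (tensor_completion G)"
proof -
  let ?T = "tensor_completion G"
  interpret group ?T by (rule tc_group)
  show ?thesis
  proof
    fix g h \<alpha>
    assume "g \<in> carrier ?T" "h \<in> carrier ?T" and comm: "g \<otimes>\<^bsub>?T\<^esub> h = h \<otimes>\<^bsub>?T\<^esub> g"
    then obtain s t where [simp]: "g = qcls G s" "h = qcls G t" by (auto simp: tc_simps)
    have "qeq G (Mul s t) (Mul t s)" using comm by (simp add: tc_simps qcls_eq_iff)
    from qeq.pow_commute[OF this] show "(g \<otimes>\<^bsub>?T\<^esub> h) \<^bold>^\<^bsub>?T\<^esub> \<alpha> = g \<^bold>^\<^bsub>?T\<^esub> \<alpha> \<otimes>\<^bsub>?T\<^esub> h \<^bold>^\<^bsub>?T\<^esub> \<alpha>"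
      by (simp add: tc_simps qcls_eq_iff)
  qed (clarsimp simp: tc_simps rangeI tc_inv qcls_eq_iff qeq.pow_one qeq.pow_zero qeq.one_pow
        qeq.pow_add qeq.pow_mult qeq.pow_conj)+
qed

lemma tc_map_hom: "tensor_map G \<in> hom G (tensor_completion G)"
  by (rule homI) (auto simp: tensor_map_def tc_simps qcls_eq_iff intro: qeq.gen_mult)

primrec qeval :: "('a, 'm) monoid_scheme \<Rightarrow> 'c qgroup \<Rightarrow> ('a \<Rightarrow> 'c) \<Rightarrow> 'a qterm \<Rightarrow> 'c" where
  "qeval G K f (Gen x) = (if x \<in> carrier G then f x else \<one>\<^bsub>K\<^esub>)"
| "qeval G K f One = \<one>\<^bsub>K\<^esub>"
| "qeval G K f (Mul s t) = qeval G K f s \<otimes>\<^bsub>K\<^esub> qeval G K f t"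
| "qeval G K f (Inv s) = inv\<^bsub>K\<^esub> (qeval G K f s)"
| "qeval G K f (QPow s \<alpha>) = qeval G K f s \<^bold>^\<^bsub>K\<^esub> \<alpha>"

lemma qeval_closed:
  assumes "Q_group K" "f \<in> hom G K"
  shows "qeval G K f t \<in> carrier K"
proof -
  interpret Q_group K by fact
  show ?thesis
    using assms(2) by (induction t) (auto simp: hom_def qpow_closed)
qed

lemma qeval_cong:
  assumes "group G" "Q_group K" "f \<in> hom G K" "qeq G s t"
  shows "qeval G K f s = qeval G K f t"
proof -
  interpret G: group G by fact
  interpret Q_group K by fact
  note closed [simp] = qeval_closed[OF assms(2,3)]
  have f: "f (x \<otimes>\<^bsub>G\<^esub> y) = f x \<otimes>\<^bsub>K\<^esub> f y" if "x \<in> carrier G" "y \<in> carrier G" for x y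
    using assms(3) that by (auto simp: hom_def)
  show ?thesis
    using assms(4)
  proof induction
    case (pow_conj t s \<alpha>)
    show ?case using qpow_conj[OF closed closed] by simp
  next
    case (pow_commute s t \<alpha>)
    then show ?case using qpow_commute[OF closed closed] by simp
  qed (simp_all add: f m_assoc qpow_one qpow_zero one_qpow qpow_add qpow_mult)
qed

lemma tc_unique:
  assumes "group G" "Q_group K" "f \<in> hom G K" "\<phi> \<in> Q_hom (tensor_completion G) K"
    and "\<forall>g \<in> carrier G. \<phi> (tensor_map G g) = f g"
  shows "\<phi> (qcls G t) = qeval G K f t"
proof (induction t)
  have hom: "group_hom (tensor_completion G) K \<phi>"
    using assms tc_group by (auto simp: group_hom_def group_hom_axioms_def Q_group_def Q_hom_def)
  {
    case (Gen x)
    have "qcls G (Gen x) = \<one>\<^bsub>tensor_completion G\<^esub>" if "x \<notin> carrier G"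
      using that by (auto simp: tc_simps qcls_eq_iff intro: qeq.gen_outside)
    then show ?case
      using assms(5) group_hom.hom_one[OF hom] by (auto simp: tensor_map_def)
  next
    case One
    then show ?case using group_hom.hom_one[OF hom] by (simp add: tc_simps)
  next
    case (Mul s t)
    then show ?case
      using group_hom.hom_mult[OF hom, of "qcls G s" "qcls G t"] by (simp add: tc_simps)
  next
    case (Inv t)
    then show ?case
      using group_hom.hom_inv[OF hom, of "qcls G t"] by (simp add: tc_simps tc_inv)
  next
    case (QPow t \<alpha>)
    have "\<phi> (qcls G t \<^bold>^\<^bsub>tensor_completion G\<^esub> \<alpha>) = \<phi> (qcls G t) \<^bold>^\<^bsub>K\<^esub> \<alpha>"
      using assms(4) unfolding Q_hom_def tc_simps(1) by blast
    with QPow show ?case by (simp add: tc_simps)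
  }
qed

theorem tensor_completion_universal:
  assumes G: "group G"
  shows "is_tensor_completion TYPE('c) G (tensor_completion G) (tensor_map G)"
  unfolding is_tensor_completion_def
proof (intro conjI allI impI tc_Q_group tc_map_hom)
  fix K :: "'c qgroup" and f
  assume K: "Q_group K" and f: "f \<in> hom G K"
  let ?T = "tensor_completion G"
  define \<phi> where "\<phi> = restrict (\<lambda>A. qeval G K f (qrep A)) (carrier ?T)"
  have \<phi>: "\<phi> (qcls G t) = qeval G K f t" for t
    using qeval_cong[OF G K f qeq_qrep, of t] by (simp add: \<phi>_def tc_simps)
  show "\<exists>!\<phi>. \<phi> \<in> Q_hom ?T K \<and> \<phi> \<in> extensional (carrier ?T) \<and>
          (\<forall>g\<in>carrier G. \<phi> (tensor_map G g) = f g)"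
  proof (rule ex1I[of _ \<phi>])
    show "\<phi> \<in> Q_hom ?T K \<and> \<phi> \<in> extensional (carrier ?T) \<and>
          (\<forall>g\<in>carrier G. \<phi> (tensor_map G g) = f g)"
      using qeval_closed[OF K f]
      by (auto simp: Q_hom_def hom_def tc_simps \<phi> tensor_map_def) (simp add: \<phi>_def tc_simps)
  next
    fix \<psi>
    assume \<psi>: "\<psi> \<in> Q_hom ?T K \<and> \<psi> \<in> extensional (carrier ?T) \<and>
          (\<forall>g\<in>carrier G. \<psi> (tensor_map G g) = f g)"
    show "\<psi> = \<phi>"
    proof (rule extensionalityI[where A = "carrier ?T"])
      show "\<psi> x = \<phi> x" if "x \<in> carrier ?T" for x
        using that tc_unique[OF G K f, of \<psi>] \<psi> by (auto simp: tc_simps \<phi>)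
    qed (use \<psi> in \<open>auto simp: \<phi>_def\<close>)
  qed
qed

lemma Q_hom_compose:
  assumes "Q_group H" "\<phi> \<in> Q_hom H K" "\<psi> \<in> Q_hom K L"
  shows "compose (carrier H) \<psi> \<phi> \<in> Q_hom H L"
proof -
  interpret Q_group H by fact
  have "\<phi> h \<in> carrier K" if "h \<in> carrier H" for h
    using assms(2) that by (auto simp: Q_hom_def hom_def)
  then show ?thesis
    using assms(2,3) by (auto simp: Q_hom_def hom_def compose_def qpow_closed)
qed

lemma is_tensor_completion_factor:
  fixes K :: "'c qgroup"
  assumes "is_tensor_completion TYPE('c) G H l" "Q_group K" "f \<in> hom G K"
  obtains \<phi> where "\<phi> \<in> Q_hom H K" "\<And>g. g \<in> carrier G \<Longrightarrow> \<phi> (l g) = f g"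
  using assms unfolding is_tensor_completion_def by blast

lemma is_tensor_completion_unique:
  fixes K :: "'c qgroup"
  assumes tc: "is_tensor_completion TYPE('c) G H l"
    and K: "Q_group K"
    and f: "\<phi> \<in> Q_hom H K" "\<psi> \<in> Q_hom H K" "\<And>g. g \<in> carrier G \<Longrightarrow> \<phi> (l g) = \<psi> (l g)"
    and x: "x \<in> carrier H"
  shows "\<phi> x = \<psi> x"
proof -
  have H: "Q_group H" and l: "l \<in> hom G H" using tc by (auto simp: is_tensor_completion_def)
  interpret Q_group H by fact
  have lc: "l g \<in> carrier H" if "g \<in> carrier G" for g using l that by (auto simp: hom_def)
  have c: "\<phi> \<circ> l \<in> hom G K" using f(1) Group.hom_compose[OF l, of \<phi> K] by (auto simp: Q_hom_def)
  have ex: "\<And>f. f \<in> hom G K \<Longrightarrow> \<exists>!\<chi>. \<chi> \<in> Q_hom H K \<and> \<chi> \<in> extensional (carrier H) \<and>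
      (\<forall>g \<in> carrier G. \<chi> (l g) = f g)"
    using tc K by (simp add: is_tensor_completion_def)
  have r: "restrict \<chi> (carrier H) \<in> Q_hom H K" if "\<chi> \<in> Q_hom H K" for \<chi>
    using that by (auto simp: Q_hom_def hom_def qpow_closed)
  have "restrict \<phi> (carrier H) = restrict \<psi> (carrier H)"
  proof (rule Uniq_D[OF conjunct2[OF iffD1[OF ex1_iff_ex_Uniq ex[OF c]]]])
    show "restrict \<phi> (carrier H) \<in> Q_hom H K \<and> restrict \<phi> (carrier H) \<in> extensional (carrier H) \<and>
        (\<forall>g \<in> carrier G. restrict \<phi> (carrier H) (l g) = (\<phi> \<circ> l) g)"
      using r[OF f(1)] lc by simp
    show "restrict \<psi> (carrier H) \<in> Q_hom H K \<and> restrict \<psi> (carrier H) \<in> extensional (carrier H) \<and>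
        (\<forall>g \<in> carrier G. restrict \<psi> (carrier H) (l g) = (\<phi> \<circ> l) g)"
      using r[OF f(2)] lc f(3) by simp
  qed
  then show ?thesis using x by (metis restrict_apply')
qed

theorem is_tensor_completion_any_type:
  fixes G :: "('a, 'm) monoid_scheme" and H :: "'b qgroup"
  assumes G: "group G"
    and tc: "is_tensor_completion TYPE('a qterm set) G H l"
    and tc': "is_tensor_completion TYPE('b) G H l"
  shows "is_tensor_completion TYPE('c) G H l"
proof -
  let ?T = "tensor_completion G" and ?t = "tensor_map G"
  have H: "Q_group H" and l: "l \<in> hom G H" using tc by (auto simp: is_tensor_completion_def)
  note lc = hom_in_carrier[OF l]
  interpret H: Q_group H by fact
  obtain \<alpha> where \<alpha>: "\<alpha> \<in> Q_hom ?T H" "\<And>g. g \<in> carrier G \<Longrightarrow> \<alpha> (?t g) = l g"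
    using is_tensor_completion_factor[OF tensor_completion_universal[OF G] H l] by blast
  obtain \<beta> where \<beta>: "\<beta> \<in> Q_hom H ?T" "\<And>g. g \<in> carrier G \<Longrightarrow> \<beta> (l g) = ?t g"
    using is_tensor_completion_factor[OF tc tc_Q_group tc_map_hom] by blast
  have \<beta>c: "\<beta> x \<in> carrier ?T" if "x \<in> carrier H" for x
    using \<beta>(1) that by (auto simp: Q_hom_def hom_def)
  have id: "restrict id (carrier H) \<in> Q_hom H H"
    by (auto simp: Q_hom_def hom_def H.qpow_closed)
  have \<alpha>\<beta>: "\<alpha> (\<beta> x) = x" if "x \<in> carrier H" for x
    using is_tensor_completion_unique[OF tc' H Q_hom_compose[OF H \<beta>(1) \<alpha>(1)] id _ that]
      that \<alpha>(2) \<beta>(2) lc by (simp add: compose_def)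
  show ?thesis
    unfolding is_tensor_completion_def
  proof (intro conjI allI impI H l)
    fix K :: "'c qgroup" and f
    assume K: "Q_group K" and f: "f \<in> hom G K"
    obtain \<chi> where \<chi>: "\<chi> \<in> Q_hom ?T K" "\<And>g. g \<in> carrier G \<Longrightarrow> \<chi> (?t g) = f g"
      using is_tensor_completion_factor[OF tensor_completion_universal[OF G] K f] by blast
    show "\<exists>!\<phi>. \<phi> \<in> Q_hom H K \<and> \<phi> \<in> extensional (carrier H) \<and> (\<forall>g\<in>carrier G. \<phi> (l g) = f g)"
    proof (rule ex1I[of _ "compose (carrier H) \<chi> \<beta>"])
      show "compose (carrier H) \<chi> \<beta> \<in> Q_hom H K \<and>
          compose (carrier H) \<chi> \<beta> \<in> extensional (carrier H) \<and>
          (\<forall>g\<in>carrier G. compose (carrier H) \<chi> \<beta> (l g) = f g)"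
        using Q_hom_compose[OF H \<beta>(1) \<chi>(1)] \<beta>(2) \<chi>(2) lc by (simp add: compose_def)
    next
      fix \<psi>
      assume \<psi>: "\<psi> \<in> Q_hom H K \<and> \<psi> \<in> extensional (carrier H) \<and> (\<forall>g\<in>carrier G. \<psi> (l g) = f g)"
      have tmc: "?t g \<in> carrier ?T" if "g \<in> carrier G" for g
        using that by (rule hom_in_carrier[OF tc_map_hom])
      have *: "\<psi> (\<alpha> y) = \<chi> y" if "y \<in> carrier ?T" for y
        using is_tensor_completion_unique[OF tensor_completion_universal[OF G] K
            Q_hom_compose[OF tc_Q_group \<alpha>(1)] \<chi>(1) _ that, of \<psi>] \<psi> that tmc \<alpha>(2) \<chi>(2)
        by (simp add: compose_def)
      show "\<psi> = compose (carrier H) \<chi> \<beta>"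
      proof (rule extensionalityI[where A = "carrier H"])
        show "\<psi> x = compose (carrier H) \<chi> \<beta> x" if "x \<in> carrier H" for x
          using *[OF \<beta>c[OF that]] \<alpha>\<beta>[OF that] that by (simp add: compose_def)
      qed (use \<psi> in auto)
    qed
  qed
qed

lemma inj_on_tensor_map_iff:
  fixes G :: "('a, 'm) monoid_scheme" and H :: "'b qgroup"
  assumes G: "group G" and tc: "is_tensor_completion TYPE('a qterm set) G H l"
  shows "inj_on l (carrier G) \<longleftrightarrow> inj_on (tensor_map G) (carrier G)"
proof -
  have H: "Q_group H" and l: "l \<in> hom G H" using tc by (auto simp: is_tensor_completion_def)
  obtain \<alpha> where "\<alpha> \<in> Q_hom (tensor_completion G) H" and \<alpha>: "\<And>g. g \<in> carrier G \<Longrightarrow> \<alpha> (tensor_map G g) = l g"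
    using is_tensor_completion_factor[OF tensor_completion_universal[OF G] H l] by blast
  obtain \<beta> where "\<beta> \<in> Q_hom H (tensor_completion G)" and \<beta>: "\<And>g. g \<in> carrier G \<Longrightarrow> \<beta> (l g) = tensor_map G g"
    using is_tensor_completion_factor[OF tc tc_Q_group tc_map_hom] by blast
  show ?thesis
  proof
    show "inj_on (tensor_map G) (carrier G)" if "inj_on l (carrier G)"
      by (rule inj_onI) (metis \<alpha> inj_onD[OF that])
    show "inj_on l (carrier G)" if "inj_on (tensor_map G) (carrier G)"
      by (rule inj_onI) (metis \<beta> inj_onD[OF that])
  qed
qed

theorem Q_faithful_iff:
  fixes G :: "('a, 'm) monoid_scheme" and H :: "'b qgroup"
  assumes G: "group G" and tc: "is_tensor_completion TYPE('a qterm set) G H l"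
  shows "Q_faithful G \<longleftrightarrow> inj_on l (carrier G)"
proof -
  have T: "is_tensor_completion TYPE('a qterm set) G (tensor_completion G) (tensor_map G)"
    by (rule tensor_completion_universal[OF G])
  have "Q_faithful G \<longleftrightarrow> inj_on (tensor_map G) (carrier G)"
  proof
    assume "Q_faithful G"
    then obtain H' :: "'a qterm set qgroup" and l'
      where H': "is_tensor_completion TYPE('a qterm set) G H' l'" and "inj_on l' (carrier G)"
      unfolding Q_faithful_def by (elim exE conjE)
    then show "inj_on (tensor_map G) (carrier G)" using inj_on_tensor_map_iff[OF G H'] by simp
  next
    assume "inj_on (tensor_map G) (carrier G)"
    with T show "Q_faithful G" unfolding Q_faithful_def by (intro exI conjI)
  qed
  then show ?thesis using inj_on_tensor_map_iff[OF G tc] by simp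
qed

end

theory Submission
  imports Defs "HOL-Algebra.Multiplicative_Group" "HOL-Number_Theory.Cong"
begin

text \<open>A finite group of order \<open>m\<close> admits exponents \<open>a / b\<close> with \<open>b\<close> coprime to \<open>m\<close>: since the powers
  of an element depend only on the exponent modulo \<open>m\<close>, one raises to the power \<open>a b\<^sup>-\<^sup>1\<close> computed
  in \<open>\<int>/m\<close>. The map \<open>a / b \<mapsto> a b\<^sup>-\<^sup>1\<close> is a ring homomorphism, so the laws of \<open>\<rat>\<close>-groups hold as
  long as only such exponents occur. An equation between terms that is a consequence of these laws
  and of the multiplication table of \<open>G\<close> has a derivation, which involves only finitely many
  denominators. It therefore holds in every finite quotient of \<open>G\<close> whose order is coprime to a
  certain integer \<open>d > 0\<close> that depends on the equation alone (\<open>qeq_sound_away_from_denominator\<close>).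

  Suppose now that elements \<open>x\<close> and \<open>y\<close> of \<open>G\<close> become equal in the tensor completion. The
  corresponding equation of generators has such a \<open>d\<close>, and all but finitely many primes \<open>p\<close> both
  fail to divide \<open>d\<close> and make \<open>G\<close> residually \<open>p\<close>. For one of them, \<open>x\<close> and \<open>y\<close> agree in every
  quotient of \<open>p\<close>-power order, whence \<open>x = y\<close>.

  The argument amounts to embedding \<open>G\<close> in the product over \<open>p\<close> of products of finite \<open>p\<close>-groups,
  modulo equality at almost all \<open>p\<close>; that group has unique roots because \<open>n\<close>-th roots
  exist uniquely in a finite \<open>p\<close>-group unless \<open>p\<close> divides \<open>n\<close>. Working with derivations spares the
  construction of this group.\<close>

section \<open>Reduction of rational numbers modulo an integer\<close>

definition residue :: "int \<Rightarrow> rat \<Rightarrow> int" where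
  "residue m \<alpha> = (SOME k. [k * snd (quotient_of \<alpha>) = fst (quotient_of \<alpha>)] (mod m))"

text \<open>The denominator of the reduced fraction divides \<open>b\<close>, so it is invertible modulo \<open>m\<close> as well and can
  be cancelled. The fraction need not be in lowest terms, so that sums and products of
  fractions can be reduced without cancelling.\<close>

lemma residue_fraction:
  assumes "b > 0" "coprime b m"
  shows "[residue m (of_int a / of_int b) * b = a] (mod m)"
proof -
  define \<alpha> :: rat where "\<alpha> = of_int a / of_int b"
  obtain n d where q: "quotient_of \<alpha> = (n, d)" by (cases "quotient_of \<alpha>")
  have d: "d > 0" and nd: "coprime n d"
    using quotient_of_denom_pos[OF q] quotient_of_coprime[OF q] by auto
  have "(of_int a :: rat) / of_int b = of_int n / of_int d"
    using quotient_of_div[OF q] by (simp add: \<alpha>_def)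
  then have "(of_int (a * d) :: rat) = of_int (n * b)"
    using d assms(1) by (simp add: field_simps)
  then have cross: "a * d = n * b" by (simp only: of_int_eq_iff)
  then have "d dvd n * b" by (metis dvd_triv_right)
  then have "d dvd b" using nd by (simp add: coprime_commute coprime_dvd_mult_right_iff)
  then have dm: "coprime d m" using coprime_divisors[OF _ dvd_refl assms(2)] by simp
  obtain e where e: "[d * e = 1] (mod m)" using cong_solve_coprime_int[OF dm] by blast
  have "[n * e * d = n] (mod m)"
    using cong_scalar_left[OF e, of n] by (simp add: ac_simps)
  then have "[residue m \<alpha> * d = n] (mod m)"
    unfolding residue_def q fst_conv snd_conv by (rule someI)
  then have "[residue m \<alpha> * d * b = n * b] (mod m)" by (rule cong_scalar_right)
  then have "[residue m \<alpha> * b * d = a * d] (mod m)" by (simp add: cross ac_simps)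
  then show ?thesis using dm by (simp add: \<alpha>_def cong_mult_rcancel)
qed

lemma residue_of_int: "[residue m (of_int a) = a] (mod m)"
  using residue_fraction[of 1 m a] by simp

lemma residue_add:
  assumes "b > 0" "d > 0" "coprime b m" "coprime d m"
    and "\<alpha> = of_int a / of_int b" "\<beta> = of_int c / of_int d"
  shows "[residue m (\<alpha> + \<beta>) = residue m \<alpha> + residue m \<beta>] (mod m)"
proof -
  have bd: "b * d > 0" "coprime (b * d) m" using assms by auto
  have sum: "\<alpha> + \<beta> = of_int (a * d + c * b) / of_int (b * d)"
    using assms by (simp add: field_simps)
  have "[residue m (\<alpha> + \<beta>) * (b * d) = a * d + c * b] (mod m)"
    unfolding sum by (rule residue_fraction[OF bd])
  moreover have "[residue m \<alpha> * b * d + residue m \<beta> * d * b = a * d + c * b] (mod m)"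
    using assms by (intro cong_add cong_mult cong_refl) (simp_all add: residue_fraction)
  ultimately have "[residue m (\<alpha> + \<beta>) * (b * d) = (residue m \<alpha> + residue m \<beta>) * (b * d)] (mod m)"
    by (simp add: algebra_simps cong_def)
  then show ?thesis using bd by (simp only: cong_mult_rcancel)
qed

lemma residue_mult:
  assumes "b > 0" "d > 0" "coprime b m" "coprime d m"
    and "\<alpha> = of_int a / of_int b" "\<beta> = of_int c / of_int d"
  shows "[residue m (\<alpha> * \<beta>) = residue m \<alpha> * residue m \<beta>] (mod m)"
proof -
  have bd: "b * d > 0" "coprime (b * d) m" using assms by auto
  have prod: "\<alpha> * \<beta> = of_int (a * c) / of_int (b * d)"
    using assms by simp
  have "[residue m (\<alpha> * \<beta>) * (b * d) = a * c] (mod m)"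
    unfolding prod by (rule residue_fraction[OF bd])
  moreover have "[residue m \<alpha> * b * (residue m \<beta> * d) = a * c] (mod m)"
    using assms by (intro cong_mult) (simp_all add: residue_fraction)
  ultimately have "[residue m (\<alpha> * \<beta>) * (b * d) = residue m \<alpha> * residue m \<beta> * (b * d)] (mod m)"
    by (simp add: ac_simps cong_def)
  then show ?thesis using bd by (simp only: cong_mult_rcancel)
qed


section \<open>Rational exponents in finite groups\<close>

lemma (in group) int_pow_cong_order:
  assumes "x \<in> carrier G" "[i = j] (mod int (order G))"
  shows "x [^] i = x [^] j"
proof -
  obtain k where k: "j = i + int (order G) * k" using assms(2) by (auto simp: cong_iff_lin)
  have "x [^] (int (order G) * k) = \<one>"
    using assms(1) by (simp add: int_pow_pow[symmetric] int_pow_int pow_order_eq_1)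
  then show ?thesis using assms(1) by (simp add: k int_pow_mult)
qed

lemma (in group) int_pow_conj:
  assumes g: "g \<in> carrier G" and h: "h \<in> carrier G"
  shows "(inv g \<otimes> h \<otimes> g) [^] (k::int) = inv g \<otimes> h [^] k \<otimes> g"
proof -
  have "(\<lambda>x. inv g \<otimes> x \<otimes> g) \<in> hom G G"
  proof (rule homI)
    fix x y assume x: "x \<in> carrier G" and y: "y \<in> carrier G"
    have "g \<otimes> (inv g \<otimes> (y \<otimes> g)) = y \<otimes> g"
      using g y by (simp flip: m_assoc)
    then show "inv g \<otimes> (x \<otimes> y) \<otimes> g = (inv g \<otimes> x \<otimes> g) \<otimes> (inv g \<otimes> y \<otimes> g)"
      using g x y by (simp add: m_assoc)
  qed (use g in simp)
  from hom_int_pow[OF this h is_group is_group] show ?thesis by simp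
qed

text \<open>If \<open>K\<close> is infinite, its order is \<open>0\<close>, and only exponents with denominator \<open>1\<close> are coprime to it;
  in that case \<open>qpow_add\<close> and \<open>qpow_mult\<close> below speak of ordinary powers.\<close>

locale residue_power_group = group K for K :: "'c qgroup" (structure) +
  assumes qpow_residue: "h \<in> carrier K \<Longrightarrow> h \<^bold>^ \<alpha> = h [^] residue (int (order K)) \<alpha>"
begin

lemma qpow_closed: "h \<in> carrier K \<Longrightarrow> h \<^bold>^ \<alpha> \<in> carrier K"
  by (simp add: qpow_residue)

lemma qpow_of_int: "h \<in> carrier K \<Longrightarrow> h \<^bold>^ of_int a = h [^] a"
  using int_pow_cong_order[OF _ residue_of_int] by (simp add: qpow_residue)

lemma qpow_add:
  assumes "h \<in> carrier K"
    and "coprime (int (order K)) (snd (quotient_of \<alpha>) * snd (quotient_of \<beta>))"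
  shows "h \<^bold>^ (\<alpha> + \<beta>) = h \<^bold>^ \<alpha> \<otimes> h \<^bold>^ \<beta>"
proof -
  have "[residue (int (order K)) (\<alpha> + \<beta>) =
      residue (int (order K)) \<alpha> + residue (int (order K)) \<beta>] (mod int (order K))"
    using assms(2)
    by (intro residue_add[OF quotient_of_denom_pos' quotient_of_denom_pos' _ _
          quotient_of_div[OF surjective_pairing] quotient_of_div[OF surjective_pairing]])
       (simp_all add: coprime_commute)
  then show ?thesis
    using assms(1) by (simp add: qpow_residue int_pow_mult[symmetric] int_pow_cong_order)
qed

lemma qpow_mult:
  assumes "h \<in> carrier K"
    and "coprime (int (order K)) (snd (quotient_of \<alpha>) * snd (quotient_of \<beta>))"
  shows "h \<^bold>^ (\<alpha> * \<beta>) = (h \<^bold>^ \<alpha>) \<^bold>^ \<beta>"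
proof -
  have "[residue (int (order K)) (\<alpha> * \<beta>) =
      residue (int (order K)) \<alpha> * residue (int (order K)) \<beta>] (mod int (order K))"
    using assms(2)
    by (intro residue_mult[OF quotient_of_denom_pos' quotient_of_denom_pos' _ _
          quotient_of_div[OF surjective_pairing] quotient_of_div[OF surjective_pairing]])
       (simp_all add: coprime_commute)
  then show ?thesis
    using assms(1) by (simp add: qpow_residue int_pow_pow int_pow_cong_order)
qed

lemma qeval_closed:
  assumes "f \<in> hom G K"
  shows "qeval G K f t \<in> carrier K"
  using assms by (induction t) (auto simp: hom_def qpow_closed)

text \<open>Raising to a rational power means raising to some integer power, whence the laws that involve a
  single exponent hold for every denominator. The exponents \<open>0\<close> and \<open>1\<close> are their own residues.\<close>

lemma qeval_integral_laws:
  assumes "f \<in> hom G K"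
  shows "qeval G K f (Mul (Mul s t) u) = qeval G K f (Mul s (Mul t u))"
    and "qeval G K f (Mul One s) = qeval G K f s"
    and "qeval G K f (Mul (Inv s) s) = qeval G K f One"
    and "qeval G K f (QPow s 1) = qeval G K f s"
    and "qeval G K f (QPow s 0) = qeval G K f One"
    and "qeval G K f (QPow One \<alpha>) = qeval G K f One"
    and "qeval G K f (QPow (Mul (Mul (Inv t) s) t) \<alpha>)
       = qeval G K f (Mul (Mul (Inv t) (QPow s \<alpha>)) t)"
  using qeval_closed[OF assms] qpow_of_int[of _ 1] qpow_of_int[of _ 0]
  by (simp_all add: m_assoc) (simp_all add: qpow_residue int_pow_conj flip: m_assoc)

end

definition with_residue_powers :: "('c, 'm) monoid_scheme \<Rightarrow> 'c qgroup" where
  "with_residue_powers P =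
     \<lparr>carrier = carrier P, monoid.mult = monoid.mult P, one = one P,
      qpow = (\<lambda>h \<alpha>. h [^]\<^bsub>P\<^esub> residue (int (order P)) \<alpha>)\<rparr>"

lemma residue_power_group_with_residue_powers:
  assumes "group P"
  shows "residue_power_group (with_residue_powers P)"
proof -
  interpret P: group P by fact
  let ?K = "with_residue_powers P"
  have K: "group ?K"
    by (rule groupI) (auto simp: with_residue_powers_def P.m_assoc intro: P.l_inv_ex)
  have "(\<lambda>x. x) \<in> hom P ?K" by (auto simp: hom_def with_residue_powers_def)
  from hom_int_pow[OF this _ P.is_group K]
  have "h [^]\<^bsub>P\<^esub> (k::int) = h [^]\<^bsub>?K\<^esub> k" if "h \<in> carrier P" for h k using that .
  then show ?thesis
    using K by (auto simp: residue_power_group_def residue_power_group_axioms_def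
        with_residue_powers_def order_def)
qed


section \<open>Soundness of the laws up to finitely many denominators\<close>

text \<open>Each use of \<open>qeq.pow_add\<close> or \<open>qeq.pow_mult\<close> in the derivation contributes its two denominators
  to \<open>d\<close>; the other laws hold for arbitrary residues and contribute nothing. The premise of
  \<open>qeq.pow_commute\<close> is itself an equation that may fail in some \<open>K\<close>, but the induction
  hypothesis supplies it whenever the order is coprime to the \<open>d\<close> of its derivation. The integer \<open>d\<close>
  precedes the quantification over \<open>K\<close>: the quotient of \<open>G\<close> is chosen only after \<open>d\<close> is known.\<close>

lemma qeq_sound_away_from_denominator:
  assumes "group G" "qeq G s t"
  shows "\<exists>d::int. d > 0 \<and>
    (\<forall>(K :: 'c qgroup) f. residue_power_group K \<longrightarrow> coprime (int (order K)) d \<longrightarrow> f \<in> hom G K \<longrightarrow>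
       qeval G K f s = qeval G K f t)"
    (is "\<exists>d. _ \<and> ?sound d s t")
proof -
  have always: "\<exists>d. d > 0 \<and> ?sound d s t"
    if "\<And>(K :: 'c qgroup) f. residue_power_group K \<Longrightarrow> f \<in> hom G K \<Longrightarrow>
      qeval G K f s = qeval G K f t" for s t
    using that by (intro exI[of _ 1]) simp
  show ?thesis
    using assms(2)
  proof induction
    case (refl s)
    show ?case by (rule always) simp
  next
    case (sym s t)
    then show ?case by metis
  next
    case (trans s t u)
    then obtain d e where "d > 0" "?sound d s t" "e > 0" "?sound e t u" by blast
    then show ?case by (intro exI[of _ "d * e"]) auto
  next
    case (mul_cong s s' t t')
    then obtain d e where "d > 0" "?sound d s s'" "e > 0" "?sound e t t'" by blast
    then show ?case by (intro exI[of _ "d * e"]) auto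
  next
    case (inv_cong s s')
    then show ?case by auto
  next
    case (pow_cong s s' \<alpha>)
    then show ?case by auto
  next
    case (pow_add s \<alpha> \<beta>)
    have "?sound (snd (quotient_of \<alpha>) * snd (quotient_of \<beta>)) (QPow s (\<alpha> + \<beta>)) (Mul (QPow s \<alpha>) (QPow s \<beta>))"
      by (simp add: residue_power_group.qpow_add residue_power_group.qeval_closed)
    then show ?case using quotient_of_denom_pos' by (meson mult_pos_pos)
  next
    case (pow_mult s \<alpha> \<beta>)
    have "?sound (snd (quotient_of \<alpha>) * snd (quotient_of \<beta>)) (QPow s (\<alpha> * \<beta>)) (QPow (QPow s \<alpha>) \<beta>)"
      by (simp add: residue_power_group.qpow_mult residue_power_group.qeval_closed)
    then show ?case using quotient_of_denom_pos' by (meson mult_pos_pos)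
  next
    case (pow_commute s t \<alpha>)
    then obtain d where d: "d > 0" "?sound d (Mul s t) (Mul t s)" by blast
    have "?sound d (QPow (Mul s t) \<alpha>) (Mul (QPow s \<alpha>) (QPow t \<alpha>))"
    proof (intro allI impI)
      fix K :: "'c qgroup" and f
      assume K: "residue_power_group K" "coprime (int (order K)) d" "f \<in> hom G K"
      interpret residue_power_group K by fact
      note closed [simp] = qeval_closed[OF K(3)]
      have "qeval G K f s \<otimes>\<^bsub>K\<^esub> qeval G K f t = qeval G K f t \<otimes>\<^bsub>K\<^esub> qeval G K f s"
        using d(2) K by simp
      then show "qeval G K f (QPow (Mul s t) \<alpha>) = qeval G K f (Mul (QPow s \<alpha>) (QPow t \<alpha>))"
        using int_pow_mult_distrib[OF _ closed closed] by (simp add: qpow_residue)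
    qed
    with d(1) show ?case by blast
  next
    case (gen_mult x y)
    interpret G: group G by fact
    show ?case using gen_mult by (intro always) (simp add: hom_mult)
  next
    case (gen_outside x)
    then show ?case by (intro always) simp
  qed (rule always, erule (1) residue_power_group.qeval_integral_laws)+
qed


section \<open>Faithfulness\<close>

theorem proposition9:
  fixes G :: "('a, 'm) monoid_scheme"
  assumes "group G"
    and "finite {p::nat. Factorial_Ring.prime p \<and> \<not> residually_p p G}"
  shows "Q_faithful G"
proof -
  interpret G: group G by fact
  have "x = y" if x: "x \<in> carrier G" and y: "y \<in> carrier G"
    and eq: "tensor_map G x = tensor_map G y" for x y
  proof (rule ccontr)
    assume "x \<noteq> y"
    have "qeq G (Gen x) (Gen y)" using eq by (simp add: tensor_map_def qcls_eq_iff)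
    from qeq_sound_away_from_denominator[where 'c = "'a set", OF assms(1) this]
    obtain d :: int where d: "d > 0" and
      sound: "\<And>(K :: 'a set qgroup) f. residue_power_group K \<Longrightarrow> coprime (int (order K)) d \<Longrightarrow>
        f \<in> hom G K \<Longrightarrow> qeval G K f (Gen x) = qeval G K f (Gen y)"
      by blast
    have "finite {p. p dvd nat d}" using d by simp
    then have "infinite ({p::nat. Factorial_Ring.prime p} -
        ({p. Factorial_Ring.prime p \<and> \<not> residually_p p G} \<union> {p. p dvd nat d}))"
      using assms(2) primes_infinite by (intro Diff_infinite_finite) auto
    then obtain p where p: "Factorial_Ring.prime p" "residually_p p G" "\<not> p dvd nat d"
      by (metis (mono_tags, lifting) DiffE UnCI finite.emptyI mem_Collect_eq all_not_in_conv)
    have "x \<otimes>\<^bsub>G\<^esub> inv\<^bsub>G\<^esub> y \<noteq> \<one>\<^bsub>G\<^esub>"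
      using x y \<open>x \<noteq> y\<close> G.inv_solve_right' by fastforce
    then obtain N k where N: "N \<lhd> G" and k: "card (rcosets\<^bsub>G\<^esub> N) = p ^ k"
      and xy: "x \<otimes>\<^bsub>G\<^esub> inv\<^bsub>G\<^esub> y \<notin> N"
      using p(2) x y unfolding residually_p_def by blast
    interpret N: normal N G by fact
    let ?K = "with_residue_powers (G Mod N)"
    have "order ?K = p ^ k"
      using k by (simp add: order_def with_residue_powers_def FactGroup_def)
    moreover have "coprime (p ^ k) (nat d)"
      using p(1,3) by (simp add: prime_imp_coprime)
    ultimately have "coprime (int (order ?K)) d"
      using d by (metis coprime_int_iff int_nat_eq less_imp_le)
    moreover have "(\<lambda>g. N #>\<^bsub>G\<^esub> g) \<in> hom G ?K"
      using N.r_coset_hom_Mod by (simp add: hom_def with_residue_powers_def)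
    ultimately have "N #>\<^bsub>G\<^esub> x = N #>\<^bsub>G\<^esub> y"
      using sound[OF residue_power_group_with_residue_powers[OF N.factorgroup_is_group]] x y
      by simp
    then have "x \<in> N #>\<^bsub>G\<^esub> y"
      using G.rcos_self[OF x N.subgroup_axioms] by simp
    then have "x \<otimes>\<^bsub>G\<^esub> inv\<^bsub>G\<^esub> y \<in> N"
      using N.rcos_module_imp[OF G.is_group] x y by blast
    with xy show False by contradiction
  qed
  then have "inj_on (tensor_map G) (carrier G)" by (rule inj_onI)
  then show ?thesis
    unfolding Q_faithful_def using tensor_completion_universal[OF assms(1)] by blast
qed

end
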